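(* Let $L>0$ and let $F:\mathbb{R}^d\to\mathbb{R}^d$ be monotone and $L$-Lipschitz, i.e. $\langle F(x)-F(y),x-y\rangle\ge 0$ and $\|F(x)-F(y)\|\le L\|x-y\|$ for all $x,y\in\mathbb{R}^d$. Assume that there exists a point where $F$ vanishes, and let $x^*\in\mathbb{R}^d$ be any point with $F(x^* )=0$. Let $0<\gamma\le \frac{1}{3L}$, let $x^0\in\mathbb{R}^d$, and let $(x^k)_{k\ge 0}$, $(\widetilde{x}^k)_{k\ge 0}$ be the iterates of the past extragradient method with stepsize $\gamma$ started at $x^0$ (with the convention $F(\widetilde{x}^{-1})=0$). For $k\ge 0$ define $$\Phi_k = \|x^k - x^*\|^2 + \frac{k+32}{3}\gamma^2\left(\|F(x^{k})\|^2 + 2\|F(x^{k}) - F(\widetilde{x}^{k-1})\|^2\right).$$ Then $\Phi_{k+1}\le \Phi_k$ for all $k\ge 0$. In particular, for all $N\ge 0$, $$\|F(x^N)\|^2 \leq \frac{3(1+32L^2\gamma^2)\|x^0 - x^*\|^2}{\gamma^2(N+32)},\qquad \mathrm{Gap}_F(x^N) \leq \frac{2\sqrt{41}\,(1+32L^2\gamma^2)\|x^0 - x^*\|^2}{\gamma\sqrt{3N+96}}.$$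
   Context: $\|\cdot\|$ and $\langle\cdot,\cdot\rangle$ are the Euclidean norm and inner product on $\mathbb{R}^d$. Past extragradient method (unconstrained) with stepsize $\gamma$: given $x^0\in\mathbb{R}^d$, for all $k\ge 0$, $$\widetilde{x}^k = x^k-\gamma F(\widetilde{x}^{k-1}),\qquad x^{k+1}=x^k-\gamma F(\widetilde{x}^k),$$ where by convention the symbol $F(\widetilde{x}^{-1})$ denotes the zero vector. (Thus $\widetilde{x}^0=x^0$ and $x^1=x^0-\gamma F(x^0)$.) Restricted gap function: for the fixed solution $x^*$ and starting point $x^0$, $$\mathrm{Gap}_F(x)=\max_{y\in\mathbb{R}^d:\ \|y-x^*\|\le R}\langle F(y),x-y\rangle,\qquad R=\tfrac{\sqrt{41}}{3}\|x^0-x^*\|.$$ *)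

theory Defs
  imports "HOL-Analysis.Analysis"
begin

text \<open>The value F(xt (k - 1)), where xt (-1) is not a point: by convention
  F(xt (-1)) denotes the zero vector.\<close>

definition past_value ::
    "('a::real_vector \<Rightarrow> 'a) \<Rightarrow> (nat \<Rightarrow> 'a) \<Rightarrow> nat \<Rightarrow> 'a" where
  "past_value F xt k = (case k of 0 \<Rightarrow> 0 | Suc j \<Rightarrow> F (xt j))"

definition past_extragradient ::
    "('a::real_vector \<Rightarrow> 'a) \<Rightarrow> real \<Rightarrow> 'a \<Rightarrow> (nat \<Rightarrow> 'a) \<Rightarrow> (nat \<Rightarrow> 'a) \<Rightarrow> bool" where
  "past_extragradient F \<gamma> x0 x xt \<longleftrightarrow>
     x 0 = x0 \<and>
     (\<forall>k. xt k = x k - \<gamma> *\<^sub>R past_value F xt k) \<and>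
     (\<forall>k. x (Suc k) = x k - \<gamma> *\<^sub>R F (xt k))"

definition peg_potential ::
    "('a::real_inner \<Rightarrow> 'a) \<Rightarrow> real \<Rightarrow> 'a \<Rightarrow> (nat \<Rightarrow> 'a) \<Rightarrow> (nat \<Rightarrow> 'a) \<Rightarrow> nat \<Rightarrow> real" where
  "peg_potential F \<gamma> xs x xt k =
     (norm (x k - xs))\<^sup>2 +
     (real k + 32) / 3 * \<gamma>\<^sup>2 *
       ((norm (F (x k)))\<^sup>2 + 2 * (norm (F (x k) - past_value F xt k))\<^sup>2)"

text \<open>The maximum over a closed ball is written as a supremum; the lemma below
  shows that it is attained, so it is a maximum, whenever F is continuous on the ball.\<close>

definition restricted_gap ::
    "('a::euclidean_space \<Rightarrow> 'a) \<Rightarrow> 'a \<Rightarrow> real \<Rightarrow> 'a \<Rightarrow> real" where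
  "restricted_gap F xs R x = (SUP y\<in>{y. norm (y - xs) \<le> R}. F y \<bullet> (x - y))"

lemma restricted_gap_is_max:
  fixes F :: "'a::euclidean_space \<Rightarrow> 'a"
  assumes R: "0 \<le> R" and cont: "continuous_on (cball xs R) F"
  shows "\<exists>y. norm (y - xs) \<le> R \<and> restricted_gap F xs R x = F y \<bullet> (x - y)"
    and "\<And>y. norm (y - xs) \<le> R \<Longrightarrow> F y \<bullet> (x - y) \<le> restricted_gap F xs R x"
proof -
  have ball: "{y. norm (y - xs) \<le> R} = cball xs R"
    by (auto simp: dist_norm norm_minus_commute)
  have "continuous_on (cball xs R) (\<lambda>y. F y \<bullet> (x - y))"
    by (intro continuous_intros cont)
  moreover have "xs \<in> cball xs R"
    using R by simp
  ultimately obtain y where y: "y \<in> cball xs R"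
      and max: "\<And>z. z \<in> cball xs R \<Longrightarrow> F z \<bullet> (x - z) \<le> F y \<bullet> (x - y)"
    using continuous_attains_sup[OF compact_cball, of xs R "\<lambda>y. F y \<bullet> (x - y)"] by blast
  have gap: "restricted_gap F xs R x = F y \<bullet> (x - y)"
    unfolding restricted_gap_def ball
    by (rule cSup_eq_maximum) (use y max in blast)+
  then show "\<exists>y. norm (y - xs) \<le> R \<and> restricted_gap F xs R x = F y \<bullet> (x - y)"
    using y by (auto simp: dist_norm norm_minus_commute)
  show "\<And>y. norm (y - xs) \<le> R \<Longrightarrow> F y \<bullet> (x - y) \<le> restricted_gap F xs R x"
    unfolding gap by (rule max) (simp add: dist_norm norm_minus_commute)
qed

end

(* Rescale F by \<gamma>, so that the step size is 1 and the Lipschitz constant at most 1/3, and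
   write a, b, c, p for the rescaled F(x^k), F(xt^k), F(x^(k+1)), F(xt^(k-1)). The differences of the
   points are then linear in b and p: x^k - x^(k+1) = b, x^k - xt^k = p, xt^k - x^(k+1) = b - p.
   Monotonicity between x^k and x^(k+1) and the Lipschitz bound between xt^k and x^(k+1) show that
   |a|^2 + 2 |a - p|^2 drops by at least |b - p|^2 / 3 in each step, while monotonicity between xt^k
   and the solution gives |x^(k+1) - xs|^2 \<le> |x^k - xs|^2 - |p|^2 + |b - p|^2. Since
   |c| \<le> |p| + 4/3 |b - p|, a weight of at least 32/3 on the first quantity absorbs the growth of
   the weight. Nothing is assumed about p, so the first step needs no separate treatment.
   The gap bound is Cauchy-Schwarz, because the potential keeps x^N in the ball of radius R. *)
theory Submission imports Defs begin

text \<open>Polarising \<open>mono\<close> gives |c|^2 \<le> |a|^2 - |a - b|^2 + |c - b|^2. The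
  Lipschitz bound then pays for 3 |c - b|^2 with |b - p|^2 / 3, and the term - |a - b|^2 has to
  supply the drop.\<close>

lemma residual_decrease:
  fixes a b c p :: "'a::real_inner"
  assumes mono: "0 \<le> (a - c) \<bullet> b"
    and lip: "norm (b - c) \<le> norm (b - p) / 3"
  shows "(norm c)\<^sup>2 + 2 * (norm (c - b))\<^sup>2
    \<le> (norm a)\<^sup>2 + 2 * (norm (a - p))\<^sup>2 - (norm (b - p))\<^sup>2 / 3"
proof -
  have "(norm (b - c))\<^sup>2 \<le> (norm (b - p) / 3)\<^sup>2"
    using lip by (intro power_mono) auto
  then have lip2: "9 * (norm (c - b))\<^sup>2 \<le> (norm (b - p))\<^sup>2"
    by (simp add: power_divide norm_minus_commute)
  have mono2: "(norm (a - b))\<^sup>2 - (norm (c - b))\<^sup>2 \<le> (norm a)\<^sup>2 - (norm c)\<^sup>2"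
    using mono by (simp add: power2_norm_eq_inner algebra_simps inner_commute)
  \<comment> \<open>This square encodes the weighted triangle inequality 2 |b - p|^2 \<le> 3 |a -
    b|^2 + 6 |a - p|^2. A third of it turns - |a - b|^2 into 2 |a - p|^2 - 2/3 |b - p|^2.\<close>
  have "0 \<le> (norm ((a - b) + 2 *\<^sub>R (a - p)))\<^sup>2"
    by simp
  also have "\<dots> = 3 * (norm (a - b))\<^sup>2 + 6 * (norm (a - p))\<^sup>2 - 2 * (norm (b - p))\<^sup>2"
    by (simp add: power2_norm_eq_inner algebra_simps inner_commute)
  finally show ?thesis
    using lip2 mono2 by linarith
qed

lemma potential_step:
  fixes a b c p d :: "'a::real_inner"
  assumes mono: "0 \<le> (a - c) \<bullet> b"
    and sol: "0 \<le> b \<bullet> (d - p)"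
    and lip: "norm (b - c) \<le> norm (b - p) / 3"
    and t: "32 / 3 \<le> t"
  shows "(norm (d - b))\<^sup>2 + (t + 1 / 3) * ((norm c)\<^sup>2 + 2 * (norm (c - b))\<^sup>2)
    \<le> (norm d)\<^sup>2 + t * ((norm a)\<^sup>2 + 2 * (norm (a - p))\<^sup>2)"
proof -
  define S where "S = (norm a)\<^sup>2 + 2 * (norm (a - p))\<^sup>2"
  define S' where "S' = (norm c)\<^sup>2 + 2 * (norm (c - b))\<^sup>2"
  define P where "P = norm p"
  define Q where "Q = norm (b - p)"
  \<comment> \<open>Replacing b \<bullet> d by the smaller b \<bullet> p in the expanded square
    leaves |b|^2 - 2 b \<bullet> p, which is Q^2 - P^2.\<close>
  have dist: "(norm (d - b))\<^sup>2 \<le> (norm d)\<^sup>2 - P\<^sup>2 + Q\<^sup>2"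
    using sol unfolding P_def Q_def
    by (simp add: power2_norm_eq_inner algebra_simps inner_commute)
  have "S' \<le> S - Q\<^sup>2 / 3"
    using residual_decrease[OF mono lip] by (simp add: S_def S'_def Q_def)
  then have "t * S' \<le> t * (S - Q\<^sup>2 / 3)"
    using t by (intro mult_left_mono) auto
  moreover have "32 / 3 * Q\<^sup>2 \<le> t * Q\<^sup>2"
    using t by (intro mult_right_mono) auto
  ultimately have decrease: "t * S' \<le> t * S - 32 / 9 * Q\<^sup>2"
    by (simp add: algebra_simps)
  have lip': "norm (c - b) \<le> Q / 3"
    using lip by (simp add: Q_def norm_minus_commute)
  \<comment> \<open>The route goes through p because -P^2 and a negative multiple of Q^2 are what is
    available to absorb the growth S' / 3.\<close>
  have "c = p + (b - p) + (c - b)"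
    by simp
  then have "norm c \<le> P + Q + norm (c - b)"
    unfolding P_def Q_def by (metis norm_triangle_ineq norm_triangle_mono order_refl)
  then have "norm c \<le> P + 4 / 3 * Q"
    using lip' by linarith
  then have "(norm c)\<^sup>2 \<le> (P + 4 / 3 * Q)\<^sup>2"
    by (intro power_mono) auto
  \<comment> \<open>Young's inequality, with the coefficient 3 chosen so that a third of the bound
    cancels -P^2 exactly; the gap is 2/9 (3 P - 2 Q)^2.\<close>
  also have "\<dots> \<le> 3 * P\<^sup>2 + 8 / 3 * Q\<^sup>2"
    using zero_le_power2[of "3 * P - 2 * Q"] by (simp add: power2_eq_square algebra_simps)
  finally have c: "(norm c)\<^sup>2 \<le> 3 * P\<^sup>2 + 8 / 3 * Q\<^sup>2" .
  have "(norm (c - b))\<^sup>2 \<le> (Q / 3)\<^sup>2"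
    using lip' by (intro power_mono) auto
  then have "S' \<le> 3 * P\<^sup>2 + 26 / 9 * Q\<^sup>2"
    using c by (simp add: S'_def power_divide)
  moreover have "0 \<le> Q\<^sup>2"
    by simp
  moreover have "(t + 1 / 3) * S' = t * S' + S' / 3"
    by (simp add: algebra_simps)
  \<comment> \<open>The P^2 terms cancel, and Q^2 is left with the coefficient 1 + 26/27 - 32/9 <
    0.\<close>
  ultimately have "(norm (d - b))\<^sup>2 + (t + 1 / 3) * S' \<le> (norm d)\<^sup>2 + t * S"
    using dist decrease by linarith
  then show ?thesis
    unfolding S_def S'_def .
qed

lemma peg_potential_decreasing:
  fixes F :: "'a::real_inner \<Rightarrow> 'a"
  assumes mono: "\<And>u v. 0 \<le> (F u - F v) \<bullet> (u - v)"
    and lip: "L-lipschitz_on UNIV F"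
    and sol: "F xs = 0"
    and \<gamma>: "0 < \<gamma>" "\<gamma> * L \<le> 1 / 3"
    and peg: "past_extragradient F \<gamma> x0 x xt"
  shows "peg_potential F \<gamma> xs x xt (Suc k) \<le> peg_potential F \<gamma> xs x xt k"
proof -
  define a where "a = \<gamma> *\<^sub>R F (x k)"
  define b where "b = \<gamma> *\<^sub>R F (xt k)"
  define c where "c = \<gamma> *\<^sub>R F (x (Suc k))"
  define p where "p = \<gamma> *\<^sub>R past_value F xt k"
  define d where "d = x k - xs"
  have xt: "xt k = x k - p" and xS: "x (Suc k) = x k - b"
    using peg unfolding past_extragradient_def p_def b_def by blast+
  have "0 \<le> \<gamma> * ((F (x k) - F (x (Suc k))) \<bullet> (x k - x (Suc k)))"
    using mono \<gamma> by (intro mult_nonneg_nonneg) auto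
  then have 1: "0 \<le> (a - c) \<bullet> b"
    by (simp add: a_def c_def xS inner_diff_left right_diff_distrib)
  have "0 \<le> \<gamma> * ((F (xt k) - F xs) \<bullet> (xt k - xs))"
    using mono \<gamma> by (intro mult_nonneg_nonneg) auto
  also have "xt k - xs = d - p"
    by (simp add: xt d_def)
  finally have 2: "0 \<le> b \<bullet> (d - p)"
    by (simp add: b_def sol)
  have "norm (b - c) = \<gamma> * dist (F (xt k)) (F (x (Suc k)))"
    using \<gamma> by (simp add: b_def c_def dist_norm flip: scaleR_diff_right)
  also have "\<dots> \<le> \<gamma> * (L * dist (xt k) (x (Suc k)))"
    using lipschitz_onD[OF lip] \<gamma> by (intro mult_left_mono) auto
  also have "dist (xt k) (x (Suc k)) = norm (b - p)"
    by (simp add: xt xS dist_norm)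
  also have "\<gamma> * (L * norm (b - p)) \<le> 1 / 3 * norm (b - p)"
    unfolding mult.assoc[symmetric] using \<gamma> by (intro mult_right_mono) auto
  finally have 3: "norm (b - c) \<le> norm (b - p) / 3"
    by simp
  have scale: "\<gamma>\<^sup>2 * ((norm u)\<^sup>2 + 2 * (norm (u - v))\<^sup>2)
      = (norm (\<gamma> *\<^sub>R u))\<^sup>2 + 2 * (norm (\<gamma> *\<^sub>R u - \<gamma> *\<^sub>R v))\<^sup>2" for u v :: 'a
    by (simp add: power_mult_distrib algebra_simps flip: scaleR_diff_right)
  have "peg_potential F \<gamma> xs x xt k
      = (norm d)\<^sup>2 + (real k + 32) / 3 * ((norm a)\<^sup>2 + 2 * (norm (a - p))\<^sup>2)"
    unfolding peg_potential_def mult.assoc scale by (simp add: a_def p_def d_def)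
  \<comment> \<open>At index \<open>Suc k\<close> the past value is \<open>F (xt k)\<close>, so b
    takes over the role of p, and the weight has grown by 1/3.\<close>
  moreover have "peg_potential F \<gamma> xs x xt (Suc k)
      = (norm (d - b))\<^sup>2 + ((real k + 32) / 3 + 1 / 3) * ((norm c)\<^sup>2 + 2 * (norm (c - b))\<^sup>2)"
    unfolding peg_potential_def mult.assoc scale
    by (simp add: past_value_def b_def c_def d_def xS field_simps)
  ultimately show ?thesis
    using potential_step[OF 1 2 3, of "(real k + 32) / 3"] by simp
qed

text \<open>Monotonicity replaces \<open>F y\<close> by \<open>F x\<close>, after which y enters
  only through its distance to x, at most the diameter of the ball.\<close>

lemma restricted_gap_le:
  fixes F :: "'a::euclidean_space \<Rightarrow> 'a"
  assumes mono: "\<And>u v. 0 \<le> (F u - F v) \<bullet> (u - v)"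
    and x: "norm (x - xs) \<le> R"
  shows "restricted_gap F xs R x \<le> 2 * R * norm (F x)"
  unfolding restricted_gap_def
proof (rule cSUP_least)
  have "0 \<le> R"
    using x norm_ge_zero by (rule order_trans[rotated])
  then show "{y. norm (y - xs) \<le> R} \<noteq> {}"
    by (auto intro!: exI[of _ xs])
next
  fix y assume "y \<in> {y. norm (y - xs) \<le> R}"
  then have "norm (x - y) \<le> 2 * R"
    using x norm_triangle_ineq4[of "x - xs" "y - xs"] by simp
  then have "norm (F x) * norm (x - y) \<le> norm (F x) * (2 * R)"
    by (intro mult_left_mono) auto
  moreover have "F y \<bullet> (x - y) \<le> F x \<bullet> (x - y)"
    using mono[of x y] by (simp add: inner_diff_left)
  ultimately show "F y \<bullet> (x - y) \<le> 2 * R * norm (F x)"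
    using norm_cauchy_schwarz[of "F x" "x - y"] by (simp add: mult.commute)
qed

theorem theorem1:
  fixes F :: "real ^ 'n \<Rightarrow> real ^ 'n"
    and L \<gamma> R :: real
    and xs x0 :: "real ^ 'n"
    and x xt :: "nat \<Rightarrow> real ^ 'n"
  assumes "0 < L"
    and "\<And>u v. 0 \<le> (F u - F v) \<bullet> (u - v)"
    and "L-lipschitz_on UNIV F"
    and "F xs = 0"
    and "0 < \<gamma>" and "\<gamma> \<le> 1 / (3 * L)"
    and "past_extragradient F \<gamma> x0 x xt"
    and "R = sqrt 41 / 3 * norm (x0 - xs)"
  shows "(\<forall>k. peg_potential F \<gamma> xs x xt (Suc k) \<le> peg_potential F \<gamma> xs x xt k) \<and>
    (\<forall>N. (norm (F (x N)))\<^sup>2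
            \<le> 3 * (1 + 32 * L\<^sup>2 * \<gamma>\<^sup>2) * (norm (x0 - xs))\<^sup>2 / (\<gamma>\<^sup>2 * (real N + 32)) \<and>
         restricted_gap F xs R (x N)
            \<le> 2 * sqrt 41 * (1 + 32 * L\<^sup>2 * \<gamma>\<^sup>2) * (norm (x0 - xs))\<^sup>2
                / (\<gamma> * sqrt (3 * real N + 96)))"
proof -
  note mono = assms(2) and lip = assms(3) and sol = assms(4) and pos = assms(5)
  define D where "D = norm (x0 - xs)"
  define C where "C = 1 + 32 * L\<^sup>2 * \<gamma>\<^sup>2"
  have \<gamma>L: "\<gamma> * L \<le> 1 / 3"
    using assms(1,6) by (simp add: field_simps)
  have decr: "peg_potential F \<gamma> xs x xt (Suc k) \<le> peg_potential F \<gamma> xs x xt k" for k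
    using peg_potential_decreasing[OF mono lip sol pos \<gamma>L assms(7)] .
  have x_0: "x 0 = x0"
    using assms(7) by (simp add: past_extragradient_def)
  have "norm (F x0) \<le> L * D"
    using lipschitz_onD[OF lip, of x0 xs] by (simp add: dist_norm sol D_def)
  then have "(norm (F x0))\<^sup>2 \<le> (L * D)\<^sup>2"
    by (intro power_mono) auto
  then have "\<gamma>\<^sup>2 * (norm (F x0))\<^sup>2 \<le> \<gamma>\<^sup>2 * (L * D)\<^sup>2"
    by (intro mult_left_mono) auto
  \<comment> \<open>With past value 0 the bracket is 3 |F(x0)|^2 and its weight is 32/3 \<gamma>^2,
    which is where the 32 in \<open>C\<close> comes from.\<close>
  then have start: "peg_potential F \<gamma> xs x xt 0 \<le> C * D\<^sup>2"
    by (simp add: peg_potential_def past_value_def x_0 C_def D_def power_mult_distrib algebra_simps)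
  have "(\<gamma> * L)\<^sup>2 \<le> (1 / 3)\<^sup>2"
    using \<gamma>L pos assms(1) by (intro power_mono) auto
  \<comment> \<open>41/9 = 1 + 32/9 is the origin of the factor \<open>sqrt 41 / 3\<close> in the
    radius.\<close>
  then have C: "1 \<le> C" "C \<le> 41 / 9"
    by (auto simp: C_def power_mult_distrib power_divide algebra_simps)
  have bounds: "(norm (F (x N)))\<^sup>2 \<le> 3 * C * D\<^sup>2 / (\<gamma>\<^sup>2 * (real N + 32))"
      "restricted_gap F xs R (x N) \<le> 2 * sqrt 41 * C * D\<^sup>2 / (\<gamma> * sqrt (3 * real N + 96))" for N
  proof -
    have "peg_potential F \<gamma> xs x xt N \<le> peg_potential F \<gamma> xs x xt 0"
      by (rule decseqD[OF decseq_SucI[of "peg_potential F \<gamma> xs x xt"]]) (simp_all add: decr)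
    then have pot: "peg_potential F \<gamma> xs x xt N \<le> C * D\<^sup>2"
      using start by linarith
    define w where "w = (real N + 32) / 3 * \<gamma>\<^sup>2"
    have w: "0 < w"
      using pos by (simp add: w_def)
    define v where "v = norm (F (x N) - past_value F xt N)"
    have "(norm (x N - xs))\<^sup>2 + (w * (norm (F (x N)))\<^sup>2 + 2 * (w * v\<^sup>2)) \<le> C * D\<^sup>2"
      using pot unfolding peg_potential_def w_def[symmetric] v_def[symmetric] distrib_left
      by (simp add: mult.left_commute)
    moreover have "0 \<le> w * v\<^sup>2" "0 \<le> w * (norm (F (x N)))\<^sup>2"
      using w by auto
    ultimately have dist: "(norm (x N - xs))\<^sup>2 \<le> C * D\<^sup>2"
      and res: "w * (norm (F (x N)))\<^sup>2 \<le> C * D\<^sup>2"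
      using zero_le_power2[of "norm (x N - xs)"] by linarith+
    have "3 * C * D\<^sup>2 / (\<gamma>\<^sup>2 * (real N + 32)) = C * D\<^sup>2 / w"
      by (simp add: w_def mult_ac)
    then show F_le: "(norm (F (x N)))\<^sup>2 \<le> 3 * C * D\<^sup>2 / (\<gamma>\<^sup>2 * (real N + 32))"
      using res w by (simp add: pos_le_divide_eq mult.commute)
    have R_nonneg: "0 \<le> R"
      by (simp add: assms(8))
    have "C * D\<^sup>2 \<le> 41 / 9 * D\<^sup>2"
      using C by (intro mult_right_mono) auto
    also have "\<dots> = R\<^sup>2"
      by (simp add: assms(8) D_def power_mult_distrib power_divide)
    finally have "norm (x N - xs) \<le> R"
      by (rule power2_le_imp_le[OF order_trans[OF dist] R_nonneg])
    then have gap: "restricted_gap F xs R (x N) \<le> 2 * R * norm (F (x N))"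
      by (rule restricted_gap_le[OF mono])
    define s where "s = sqrt (3 * real N + 96)"
    have s: "0 < s" "real N + 32 = s\<^sup>2 / 3"
      by (auto simp: s_def)
    have "3 * C * D\<^sup>2 / (\<gamma>\<^sup>2 * (real N + 32)) = C * (3 * D / (\<gamma> * s))\<^sup>2"
      by (simp add: s(2) power_mult_distrib power_divide)
    \<comment> \<open>Since C \<ge> 1, weakening C to C^2 lets the square root produce C, as the gap
      bound states, instead of its root.\<close>
    also have "\<dots> \<le> C\<^sup>2 * (3 * D / (\<gamma> * s))\<^sup>2"
      using C by (intro mult_right_mono) (auto simp: power2_eq_square)
    finally have "(norm (F (x N)))\<^sup>2 \<le> (C * (3 * D / (\<gamma> * s)))\<^sup>2"
      using F_le unfolding power_mult_distrib[of C] by linarith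
    then have "norm (F (x N)) \<le> C * (3 * D / (\<gamma> * s))"
      by (rule power2_le_imp_le) (use C pos s in \<open>simp add: D_def\<close>)
    then have "2 * R * norm (F (x N)) \<le> 2 * R * (C * (3 * D / (\<gamma> * s)))"
      using R_nonneg by (intro mult_left_mono) auto
    also have "\<dots> = 2 * sqrt 41 * C * D\<^sup>2 / (\<gamma> * s)"
      by (simp add: assms(8) D_def power2_eq_square)
    finally show "restricted_gap F xs R (x N)
        \<le> 2 * sqrt 41 * C * D\<^sup>2 / (\<gamma> * sqrt (3 * real N + 96))"
      using gap by (simp add: s_def)
  qed
  show ?thesis
    using decr bounds unfolding C_def D_def by blast
qed

end
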